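(* Let $\lambda>-1/2$, $\lambda\neq1/2$. For $z>0$ let $(P_n)_{n\ge0}$ be the monic polynomials orthogonal with respect to the weight $(1-x^2)^{\lambda-1/2}e^{-zx^2}$ on $(-1,1)$, with $xP_n=P_{n+1}+\gamma_nP_{n-1}$, $\gamma_0=0$, and let $h_n=\int_{-1}^1P_n(x)^2(1-x^2)^{\lambda-1/2}e^{-zx^2}\,dx$. Then, as functions of $z$, $h_n(z)$ and $\gamma_n(z)$ satisfy the Toda-type equations $$\partial_z\ln(h_n)=-\gamma_{n+1}-\gamma_n\quad(n\ge0),\qquad \partial_z\ln(\gamma_n)=\gamma_{n-1}-\gamma_{n+1}\quad(n\ge1).$$
   Context: The monic orthogonal polynomials satisfy $\deg P_n=n$ and $\int_{-1}^1P_nP_m(1-x^2)^{\lambda-1/2}e^{-zx^2}dx=0$ for $n\ne m$; since the weight is even, the recurrence has the stated form for $n\ge0$ with $P_{-1}=0$, $P_0=1$. One has $\gamma_n=h_n/h_{n-1}>0$ for $n\ge1$. The parameter $\lambda$ is fixed. *)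

theory Defs
  imports "HOL-Analysis.Analysis" "HOL-Computational_Algebra.Polynomial"
begin

definition gegenbauer_weight :: "real \<Rightarrow> real \<Rightarrow> real \<Rightarrow> real" where
  "gegenbauer_weight lam z x = (1 - x\<^sup>2) powr (lam - 1/2) * exp (- z * x\<^sup>2)"

definition weighted_integral :: "real \<Rightarrow> real \<Rightarrow> real poly \<Rightarrow> real" where
  "weighted_integral lam z p =
     set_lebesgue_integral lborel {-1<..<1} (\<lambda>x. poly p x * gegenbauer_weight lam z x)"

definition monic_orthogonal :: "real \<Rightarrow> real \<Rightarrow> (nat \<Rightarrow> real poly) \<Rightarrow> bool" where
  "monic_orthogonal lam z P \<longleftrightarrow>
     (\<forall>n. degree (P n) = n \<and> lead_coeff (P n) = 1) \<and>
     (\<forall>n m. n \<noteq> m \<longrightarrow> weighted_integral lam z (P n * P m) = 0)"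

text \<open>
  The case distinction at \<open>n = 0\<close> is the convention $P_{-1} = 0$; \<open>[:0, 1:]\<close> is the polynomial $x$.
\<close>

definition three_term_recurrence :: "(nat \<Rightarrow> real poly) \<Rightarrow> (nat \<Rightarrow> real) \<Rightarrow> bool" where
  "three_term_recurrence P g \<longleftrightarrow>
     g 0 = 0 \<and>
     (\<forall>n. [:0, 1:] * P n = P (n + 1) + smult (g n) (if n = 0 then 0 else P (n - 1)))"

definition sq_norm :: "real \<Rightarrow> real \<Rightarrow> (nat \<Rightarrow> real poly) \<Rightarrow> nat \<Rightarrow> real" where
  "sq_norm lam z P n = weighted_integral lam z ((P n)\<^sup>2)"

end

theory Submission
  imports Defs
begin

text \<open>
  Write \<open>L\<^sub>z\<close> for the weighted integral, \<open>h\<^sub>n\<close> for the squared norms and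
  \<open>F\<^sub>n(z) = L\<^sub>z((x P\<^sub>n)\<^sup>2) = h\<^sub>n (\<gamma>\<^sub>n\<^sub>+\<^sub>1 + \<gamma>\<^sub>n)\<close>. No regularity of \<open>P\<^sub>n\<close> in \<open>z\<close> has to
  be established: among monic polynomials of degree \<open>n\<close>, \<open>P\<^sub>n\<close> minimises \<open>L\<^sub>z(q\<^sup>2)\<close>, so comparing
  the weights at \<open>w\<close> and \<open>z\<close> through \<open>exp (-s x\<^sup>2) \<le> 1 - s x\<^sup>2 + s\<^sup>2\<close>, \<open>s = w - z\<close>, gives
  \<open>h\<^sub>n(w) \<le> (1 + s\<^sup>2) h\<^sub>n(z) - s F\<^sub>n(z)\<close>, and the same with \<open>w\<close> and \<open>z\<close> exchanged. As
  \<open>0 \<le> F\<^sub>n \<le> h\<^sub>n\<close>, this forces every \<open>h\<^sub>n\<close> to be continuous, hence also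
  \<open>F\<^sub>n = h\<^sub>n\<^sub>+\<^sub>1 + h\<^sub>n\<^sup>2 / h\<^sub>n\<^sub>-\<^sub>1\<close> (\<open>F\<^sub>0 = h\<^sub>1\<close>); the two inequalities then sandwich the difference
  quotient, and \<open>h\<^sub>n' = - F\<^sub>n\<close>.
\<close>

section \<open>Real-variable preliminaries\<close>

lemma exp_le_quadratic:
  fixes u :: real
  assumes "\<bar>u\<bar> \<le> 1"
  shows "exp u \<le> 1 + u + u\<^sup>2"
proof (cases "u \<ge> 0")
  case True
  then show ?thesis using assms exp_bound by auto
next
  case False
  \<comment> \<open>For \<open>u < 0\<close> the product telescopes to \<open>1 - u^3 >= 1\<close>.
    Replacing \<open>1 - u\<close> by the larger \<open>exp (- u)\<close> and dividing by it gives
    the bound.\<close>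
  have "1 \<le> (1 + u + u\<^sup>2) * (1 - u)"
  proof -
    have "(1 + u + u\<^sup>2) * (1 - u) = 1 + (- u) ^ 3"
      by (simp add: algebra_simps power2_eq_square power3_eq_cube)
    moreover have "(- u) ^ 3 \<ge> 0" using False by simp
    ultimately show ?thesis by simp
  qed
  also have "\<dots> \<le> (1 + u + u\<^sup>2) * exp (- u)"
    using exp_ge_add_one_self[of "- u"] assms by (intro mult_left_mono) auto
  finally show ?thesis by (simp add: exp_minus field_simps)
qed

lemma eventually_at_pos_near:
  fixes z :: real
  assumes "z > 0"
  shows "\<forall>\<^sub>F w in at z. w > 0 \<and> \<bar>w - z\<bar> \<le> 1 \<and> w \<noteq> z"
proof (intro eventually_conj)
  show "\<forall>\<^sub>F w in at z. w > 0"
    using assms by (intro order_tendstoD(1)[OF tendsto_ident_at])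
  show "\<forall>\<^sub>F w in at z. \<bar>w - z\<bar> \<le> 1"
    unfolding eventually_at by (intro exI[of _ 1]) (auto simp: dist_real_def)
  show "\<forall>\<^sub>F w in at z. w \<noteq> z" by (simp add: eventually_at_filter)
qed

text \<open>The hypothesis is used at \<open>(w, z)\<close> and at \<open>(z, w)\<close>. The second
  use brings in \<open>F w\<close> and \<open>h w\<close>, and this is where continuity of
  \<open>F\<close> and \<open>h\<close> at \<open>z\<close> enters.\<close>

lemma DERIV_from_quadratic_bounds:
  fixes h F :: "real \<Rightarrow> real"
  assumes bnd: "\<And>w z. w > 0 \<Longrightarrow> z > 0 \<Longrightarrow> \<bar>w - z\<bar> \<le> 1 \<Longrightarrow>
      h w \<le> (1 + (w - z)\<^sup>2) * h z - (w - z) * F z"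
    and "isCont h z" "isCont F z" "z > 0"
  shows "(h has_real_derivative - F z) (at z)"
proof -
  note ev = eventually_at_pos_near[OF \<open>z > 0\<close>]
  have hlim: "(h \<longlongrightarrow> h z) (at z)" and Flim: "(F \<longlongrightarrow> F z) (at z)"
    using assms by (auto simp: isCont_def)
  have "((\<lambda>w. (h w - h z) / (w - z) + F z) \<longlongrightarrow> 0) (at z)"
  proof (rule Lim_null_comparison)
    show "\<forall>\<^sub>F w in at z. norm ((h w - h z) / (w - z) + F z)
        \<le> \<bar>F w - F z\<bar> + \<bar>w - z\<bar> * (\<bar>h w\<bar> + \<bar>h z\<bar>)"
      using ev
    proof eventually_elim
      case (elim w)
      define s where "s = w - z"
      have s: "\<bar>s\<bar> > 0" using elim by (auto simp: s_def)
      have up: "h w - h z + s * F z \<le> s\<^sup>2 * h z"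
        using bnd[of w z] elim \<open>z > 0\<close> by (simp add: s_def algebra_simps)
      have lo: "h z - h w - s * F w \<le> s\<^sup>2 * h w"
        using bnd[of z w] elim \<open>z > 0\<close>
        by (simp add: s_def algebra_simps abs_minus_commute power2_commute)
      have "s\<^sup>2 * h z \<le> s\<^sup>2 * \<bar>h z\<bar>" "s\<^sup>2 * h w \<le> s\<^sup>2 * \<bar>h w\<bar>"
        by (auto intro!: mult_left_mono)
      moreover have "\<bar>s * (F w - F z)\<bar> = \<bar>s\<bar> * \<bar>F w - F z\<bar>" by (simp add: abs_mult)
      moreover have "s * (F w - F z) = s * F w - s * F z" by (simp add: algebra_simps)
      moreover have "0 \<le> s\<^sup>2 * \<bar>h z\<bar>" "0 \<le> s\<^sup>2 * \<bar>h w\<bar>" by auto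
      \<comment> \<open>\<open>up\<close> and \<open>lo\<close> enclose one quantity:
        \<open>h w - h z + s * F z\<close> lies between
        \<open>- s * (F w - F z) - s\<^sup>2 * h w\<close> and
        \<open>s\<^sup>2 * h z\<close>.\<close>
      ultimately have "\<bar>h w - h z + s * F z\<bar> \<le> \<bar>s\<bar> * \<bar>F w - F z\<bar> + (s\<^sup>2 * \<bar>h w\<bar> + s\<^sup>2 * \<bar>h z\<bar>)"
        using up lo by linarith
      also have "\<dots> = \<bar>s\<bar> * (\<bar>F w - F z\<bar> + \<bar>s\<bar> * (\<bar>h w\<bar> + \<bar>h z\<bar>))"
        unfolding power2_abs[of s, symmetric] by (simp add: algebra_simps power2_eq_square)
      finally have "\<bar>h w - h z + s * F z\<bar> / \<bar>s\<bar> \<le> \<bar>F w - F z\<bar> + \<bar>s\<bar> * (\<bar>h w\<bar> + \<bar>h z\<bar>)"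
        using s by (simp add: field_simps)
      moreover have "(h w - h z) / s + F z = (h w - h z + s * F z) / s"
        using s by (auto simp: field_simps)
      ultimately show ?case by (simp add: s_def abs_divide)
    qed
    have "((\<lambda>w. \<bar>F w - F z\<bar> + \<bar>w - z\<bar> * (\<bar>h w\<bar> + \<bar>h z\<bar>)) \<longlongrightarrow>
        \<bar>F z - F z\<bar> + \<bar>z - z\<bar> * (\<bar>h z\<bar> + \<bar>h z\<bar>)) (at z)"
      by (intro tendsto_intros hlim Flim)
    then show "((\<lambda>w. \<bar>F w - F z\<bar> + \<bar>w - z\<bar> * (\<bar>h w\<bar> + \<bar>h z\<bar>)) \<longlongrightarrow> 0) (at z)" by simp
  qed
  from tendsto_diff[OF this tendsto_const[of "F z"]] show ?thesis
    by (simp add: has_field_derivative_iff)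
qed

text \<open>Since \<open>0 <= F <= h\<close>, the linear term is absorbed into a factor
  \<open>1 + s\<^sup>2 + \<bar>s\<bar>\<close> in front of \<open>h z\<close>, where
  \<open>s = w - z\<close>. This factor is symmetric in \<open>w\<close> and \<open>z\<close>, so
  exchanging them gives the matching lower bound by division.\<close>

lemma isCont_from_quadratic_bounds:
  fixes h F :: "real \<Rightarrow> real"
  assumes bnd: "\<And>w z. w > 0 \<Longrightarrow> z > 0 \<Longrightarrow> \<bar>w - z\<bar> \<le> 1 \<Longrightarrow>
      h w \<le> (1 + (w - z)\<^sup>2) * h z - (w - z) * F z"
    and F: "\<And>z. z > 0 \<Longrightarrow> 0 \<le> F z \<and> F z \<le> h z" and "z > 0"
  shows "isCont h z"
proof -
  have le: "h w \<le> (1 + (w - z)\<^sup>2 + \<bar>w - z\<bar>) * h z" if "w > 0" "z > 0" "\<bar>w - z\<bar> \<le> 1" for w z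
  proof -
    have "- ((w - z) * F z) \<le> \<bar>w - z\<bar> * F z"
      using F[of z] that by (metis abs_ge_minus_self abs_mult abs_of_nonneg)
    also have "\<dots> \<le> \<bar>w - z\<bar> * h z" using F[of z] that by (intro mult_left_mono) auto
    finally show ?thesis using bnd[of w z] that by (simp add: algebra_simps)
  qed
  note ev = eventually_at_pos_near[OF \<open>z > 0\<close>]
  have "((\<lambda>w. h w) \<longlongrightarrow> h z) (at z)"
  proof (rule tendsto_sandwich)
    show "\<forall>\<^sub>F w in at z. h w \<le> (1 + (w - z)\<^sup>2 + \<bar>w - z\<bar>) * h z"
      using ev by eventually_elim (use le \<open>z > 0\<close> in auto)
    show "\<forall>\<^sub>F w in at z. h z / (1 + (w - z)\<^sup>2 + \<bar>w - z\<bar>) \<le> h w"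
      using ev
    proof eventually_elim
      case (elim w)
      have "1 + (w - z)\<^sup>2 + \<bar>w - z\<bar> > 0" by (simp add: add_pos_nonneg)
      then show ?case
        using le[of z w] elim \<open>z > 0\<close>
        by (simp add: divide_le_eq abs_minus_commute power2_commute mult.commute)
    qed
    have "((\<lambda>w. (1 + (w - z)\<^sup>2 + \<bar>w - z\<bar>) * h z) \<longlongrightarrow> (1 + (z - z)\<^sup>2 + \<bar>z - z\<bar>) * h z) (at z)"
      by (intro tendsto_intros)
    then show "((\<lambda>w. (1 + (w - z)\<^sup>2 + \<bar>w - z\<bar>) * h z) \<longlongrightarrow> h z) (at z)" by simp
    have "((\<lambda>w. h z / (1 + (w - z)\<^sup>2 + \<bar>w - z\<bar>)) \<longlongrightarrow> h z / (1 + (z - z)\<^sup>2 + \<bar>z - z\<bar>)) (at z)"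
      by (intro tendsto_intros) auto
    then show "((\<lambda>w. h z / (1 + (w - z)\<^sup>2 + \<bar>w - z\<bar>)) \<longlongrightarrow> h z) (at z)" by simp
  qed
  then show ?thesis by (simp add: isCont_def)
qed

text \<open>The substitution \<open>t = (1 + x) / 2\<close> turns \<open>1 - x\<^sup>2\<close> into
  \<open>4 * t * (1 - t)\<close>, which reduces the claim to the Beta integral with both parameters
  \<open>a + 1 > 0\<close>.\<close>

lemma set_integrable_one_minus_square_powr:
  fixes a :: real
  assumes "a > -1"
  shows "set_integrable lborel {-1<..<1} (\<lambda>x. (1 - x\<^sup>2) powr a)"
proof -
  let ?f = "\<lambda>t::real. t powr a * (1 - t) powr a"
  have "?f integrable_on {0..1}"
    using has_integral_Beta_real[of "a + 1" "a + 1"] assms by (auto simp: integrable_on_def)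
  then have "?f absolutely_integrable_on {0..1}"
    by (intro nonnegative_absolutely_integrable_1) auto
  then have "set_integrable lborel {0..1} ?f"
    unfolding set_integrable_def by (subst (asm) integrable_completion) auto
  then have "set_integrable lborel {0<..<1} ?f"
    by (rule set_integrable_subset) auto
  then have "integrable lborel (\<lambda>x. indicator {0<..<1} (1/2 + (1/2) * x) *\<^sub>R ?f (1/2 + (1/2) * x))"
    unfolding set_integrable_def by (rule lborel_integrable_real_affine) auto
  then have "integrable lborel (\<lambda>x. 4 powr a *
      (indicator {0<..<1} (1/2 + (1/2) * x) *\<^sub>R ?f (1/2 + (1/2) * x)))"
    by (rule integrable_mult_right)
  also have "(\<lambda>x. 4 powr a * (indicator {0<..<1} (1/2 + (1/2) * x) *\<^sub>R ?f (1/2 + (1/2) * x)))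
      = (\<lambda>x. indicator {-1<..<1} x *\<^sub>R (1 - x\<^sup>2) powr a)"
  proof
    fix x :: real
    show "4 powr a * (indicator {0<..<1} (1/2 + (1/2) * x) *\<^sub>R ?f (1/2 + (1/2) * x))
        = indicator {-1<..<1} x *\<^sub>R (1 - x\<^sup>2) powr a"
    proof (cases "x \<in> {-1<..<1}")
      case True
      have "(1 - x\<^sup>2) = 4 * ((1/2 + (1/2) * x) * (1 - (1/2 + (1/2) * x)))"
        by (simp add: field_simps power2_eq_square)
      then show ?thesis using True by (simp add: powr_mult)
    next
      case False
      then show ?thesis by (auto simp: indicator_def)
    qed
  qed
  finally show ?thesis by (simp add: set_integrable_def)
qed

section \<open>The weighted integral as a positive functional\<close>

context
  fixes lam :: real
  assumes lam: "lam > -1/2"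
begin

text \<open>The polynomial times the exponential is bounded on the compact interval, and the
  remaining factor is integrable because \<open>lam - 1/2 > -1\<close>.\<close>

lemma set_integrable_gegenbauer:
  "set_integrable lborel {-1<..<1} (\<lambda>x. poly p x * gegenbauer_weight lam z x)"
proof -
  let ?g = "\<lambda>x. poly p x * exp (- z * x\<^sup>2)"
  have "compact (?g ` {-1..1})"
    by (intro compact_continuous_image continuous_intros) auto
  then have "bounded (?g ` {-1..1})" by (rule compact_imp_bounded)
  then obtain B where "\<forall>y \<in> ?g ` {-1..1}. norm y \<le> B"
    unfolding bounded_iff by blast
  then have B: "\<bar>?g x\<bar> \<le> B" if "x \<in> {-1..1}" for x using that by simp
  have [measurable]: "(\<lambda>x. poly p x) \<in> borel_measurable borel"
    by (intro borel_measurable_continuous_onI continuous_intros)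
  show ?thesis
  proof (rule set_integrable_bound)
    show "set_integrable lborel {-1<..<1} (\<lambda>x. B * (1 - x\<^sup>2) powr (lam - 1/2))"
      using lam by (intro set_integrable_mult_right set_integrable_one_minus_square_powr) auto
    show "set_borel_measurable lborel {-1<..<1} (\<lambda>x. poly p x * gegenbauer_weight lam z x)"
      unfolding set_borel_measurable_def gegenbauer_weight_def by measurable
    show "AE x in lborel. x \<in> {-1<..<1} \<longrightarrow> norm (poly p x * gegenbauer_weight lam z x)
        \<le> norm (B * (1 - x\<^sup>2) powr (lam - 1/2))"
    proof (intro AE_I2 impI)
      fix x :: real assume "x \<in> {-1<..<1}"
      then have "\<bar>?g x\<bar> \<le> \<bar>B\<bar>" using B[of x] by auto
      then have "\<bar>?g x\<bar> * (1 - x\<^sup>2) powr (lam - 1/2) \<le> \<bar>B\<bar> * (1 - x\<^sup>2) powr (lam - 1/2)"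
        by (rule mult_right_mono) simp
      then show "norm (poly p x * gegenbauer_weight lam z x)
          \<le> norm (B * (1 - x\<^sup>2) powr (lam - 1/2))"
        by (simp add: gegenbauer_weight_def abs_mult mult_ac)
    qed
  qed
qed

lemma weighted_integral_add:
  "weighted_integral lam z (p + q) = weighted_integral lam z p + weighted_integral lam z q"
  unfolding weighted_integral_def
  by (simp add: distrib_right set_integral_add(2) set_integrable_gegenbauer)

lemma weighted_integral_smult:
  "weighted_integral lam z (smult c p) = c * weighted_integral lam z p"
  unfolding weighted_integral_def by (simp add: mult.assoc)

text \<open>The two sides may carry different parameters, so weights at \<open>w\<close> and
  \<open>z\<close> can be compared.\<close>

lemma weighted_integral_mono:
  assumes "\<And>x. x \<in> {-1<..<1} \<Longrightarrow>
    poly p x * gegenbauer_weight lam w x \<le> poly q x * gegenbauer_weight lam z x"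
  shows "weighted_integral lam w p \<le> weighted_integral lam z q"
  unfolding weighted_integral_def
  by (intro set_integral_mono set_integrable_gegenbauer assms)

lemma weighted_integral_square_nonneg: "0 \<le> weighted_integral lam z (q\<^sup>2)"
  unfolding weighted_integral_def set_lebesgue_integral_def
  by (intro Bochner_Integration.integral_nonneg) (simp add: gegenbauer_weight_def indicator_def)

text \<open>If the integral vanished, so would the integrand almost everywhere. The weight is
  positive on the interval and \<open>q\<close> has finitely many roots, so the interval itself
  would be a null set.\<close>

lemma weighted_integral_square_pos:
  assumes "q \<noteq> 0"
  shows "0 < weighted_integral lam z (q\<^sup>2)"
proof (rule ccontr)
  assume "\<not> ?thesis"
  then have "weighted_integral lam z (q\<^sup>2) = 0"
    using weighted_integral_square_nonneg[of z q] by simp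
  then have "AE x in lborel.
      indicator {-1<..<1} x *\<^sub>R (poly (q\<^sup>2) x * gegenbauer_weight lam z x) = 0"
    using set_integrable_gegenbauer[of "q\<^sup>2" z]
    unfolding weighted_integral_def set_lebesgue_integral_def set_integrable_def
    by (subst (asm) integral_nonneg_eq_0_iff_AE) (auto simp: gegenbauer_weight_def)
  moreover have "AE x in lborel. x \<notin> {x. poly q x = 0}"
    by (intro AE_not_in finite_imp_null_set_lborel poly_roots_finite assms)
  ultimately have "AE x in lborel. x \<notin> {-1<..<1::real}"
  proof eventually_elim
    case (elim x)
    show ?case
    proof
      assume "x \<in> {-1<..<1}"
      moreover from this have "x\<^sup>2 < 1" by (simp add: abs_square_less_1 abs_less_iff)
      ultimately show False using elim by (simp add: gegenbauer_weight_def)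
    qed
  qed
  then have "{-1<..<1::real} \<in> null_sets lborel" by (simp add: AE_iff_null_sets)
  then show False by (simp add: null_sets_def)
qed

text \<open>The weight at \<open>w\<close> is \<open>exp (- s * x\<^sup>2)\<close> times the weight
  at \<open>z\<close>. In the quadratic bound for this factor, \<open>x\<^sup>2 <= 1\<close> lets
  \<open>s\<^sup>2\<close> replace \<open>s\<^sup>2 * x^4\<close>, so no integral with
  \<open>x^4\<close> appears.\<close>

lemma weighted_integral_square_le:
  assumes "\<bar>w - z\<bar> \<le> 1"
  shows "weighted_integral lam w (q\<^sup>2)
    \<le> (1 + (w - z)\<^sup>2) * weighted_integral lam z (q\<^sup>2)
      - (w - z) * weighted_integral lam z (([:0, 1:] * q)\<^sup>2)"
proof -
  define s where "s = w - z"
  have "weighted_integral lam w (q\<^sup>2)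
      \<le> weighted_integral lam z (smult (1 + s\<^sup>2) (q\<^sup>2) + smult (- s) (([:0, 1:] * q)\<^sup>2))"
  proof (rule weighted_integral_mono)
    fix x :: real assume "x \<in> {-1<..<1}"
    then have x: "x\<^sup>2 \<le> 1" by (simp add: abs_square_le_1 abs_le_iff)
    have "\<bar>- s * x\<^sup>2\<bar> \<le> 1"
      using assms x mult_mono[of "\<bar>s\<bar>" 1 "x\<^sup>2" 1] by (simp add: abs_mult s_def abs_minus_commute)
    then have "exp (- s * x\<^sup>2) \<le> 1 + - s * x\<^sup>2 + (- s * x\<^sup>2)\<^sup>2" by (rule exp_le_quadratic)
    also have "(- s * x\<^sup>2)\<^sup>2 \<le> s\<^sup>2"
      using x mult_left_mono[of "(x\<^sup>2)\<^sup>2" 1 "s\<^sup>2"] power_le_one[of "x\<^sup>2" 2]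
      by (simp add: power_mult_distrib)
    finally have e: "exp (- s * x\<^sup>2) \<le> 1 + s\<^sup>2 - s * x\<^sup>2" by simp
    have "gegenbauer_weight lam w x = exp (- s * x\<^sup>2) * gegenbauer_weight lam z x"
      by (simp add: gegenbauer_weight_def s_def algebra_simps flip: exp_add)
    also have "\<dots> \<le> (1 + s\<^sup>2 - s * x\<^sup>2) * gegenbauer_weight lam z x"
      by (intro mult_right_mono e) (simp add: gegenbauer_weight_def)
    finally have "(poly q x)\<^sup>2 * gegenbauer_weight lam w x
        \<le> (poly q x)\<^sup>2 * ((1 + s\<^sup>2 - s * x\<^sup>2) * gegenbauer_weight lam z x)"
      by (intro mult_left_mono) auto
    then show "poly (q\<^sup>2) x * gegenbauer_weight lam w x
        \<le> poly (smult (1 + s\<^sup>2) (q\<^sup>2) + smult (- s) (([:0, 1:] * q)\<^sup>2)) x * gegenbauer_weight lam z x"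
      by (simp add: algebra_simps power_mult_distrib)
  qed
  then show ?thesis
    by (simp add: s_def weighted_integral_add weighted_integral_smult left_diff_distrib
        del: mult_pCons_left)
qed

section \<open>Orthogonal polynomials and their recurrence at a fixed parameter\<close>

context
  fixes z :: real and P :: "nat \<Rightarrow> real poly"
  assumes orth: "monic_orthogonal lam z P"
begin

lemma monic_orthogonal_deg: "degree (P n) = n" "coeff (P n) n = 1" "P n \<noteq> 0"
proof -
  show d: "degree (P n) = n" for n using orth by (auto simp: monic_orthogonal_def)
  show "coeff (P n) n = 1" using orth d[of n] by (metis monic_orthogonal_def)
  then show "P n \<noteq> 0" by auto
qed

text \<open>Subtracting \<open>coeff r m\<close> times \<open>P m\<close> removes the top
  coefficient, so induction on \<open>m\<close> applies. Vanishing coefficients, rather than a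
  degree bound, make the base case the zero polynomial.\<close>

lemma weighted_integral_lower_degree:
  assumes "n \<ge> m" "\<forall>i\<ge>m. coeff r i = 0"
  shows "weighted_integral lam z (P n * r) = 0"
  using assms
proof (induction m arbitrary: r)
  case 0
  then have "r = 0" by (simp add: poly_eq_iff)
  then show ?case using weighted_integral_smult[of z 0 0] by simp
next
  case (Suc m)
  define r' where "r' = r - smult (coeff r m) (P m)"
  have "coeff r' i = 0" if "i \<ge> m" for i
    using Suc.prems that monic_orthogonal_deg[of m]
    by (cases "i = m") (auto simp: r'_def coeff_eq_0)
  then have "weighted_integral lam z (P n * r') = 0" using Suc by auto
  moreover have "weighted_integral lam z (P n * P m) = 0"
    using orth Suc.prems by (auto simp: monic_orthogonal_def)
  moreover have "P n * r = P n * r' + smult (coeff r m) (P n * P m)"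
    by (simp add: r'_def algebra_simps)
  ultimately show ?case by (simp add: weighted_integral_add weighted_integral_smult)
qed

text \<open>Pythagoras: \<open>q - P n\<close> has only coefficients below index \<open>n\<close>,
  hence is orthogonal to \<open>P n\<close>.\<close>

lemma sq_norm_minimal:
  assumes "degree q = n" "lead_coeff q = 1"
  shows "sq_norm lam z P n \<le> weighted_integral lam z (q\<^sup>2)"
proof -
  define r where "r = q - P n"
  have "coeff r i = 0" if "i \<ge> n" for i
    using assms that monic_orthogonal_deg[of n]
    by (cases "i = n") (auto simp: r_def coeff_eq_0)
  then have "weighted_integral lam z (P n * r) = 0"
    using weighted_integral_lower_degree[of n n r] by auto
  moreover have "q\<^sup>2 = (P n)\<^sup>2 + (smult 2 (P n * r) + r\<^sup>2)"
    unfolding poly_eq_poly_eq_iff[symmetric]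
    by (auto simp: r_def fun_eq_iff power2_eq_square algebra_simps)
  ultimately show ?thesis
    using weighted_integral_square_nonneg[of z r]
    by (simp add: weighted_integral_add weighted_integral_smult sq_norm_def)
qed

lemma sq_norm_pos: "sq_norm lam z P n > 0"
  unfolding sq_norm_def by (intro weighted_integral_square_pos monic_orthogonal_deg)

context
  fixes g :: "nat \<Rightarrow> real"
  assumes rec: "three_term_recurrence P g"
begin

text \<open>The integral of \<open>x * P n * P (Suc n)\<close> is evaluated twice, applying the
  recurrence to either factor.\<close>

lemma recurrence_coeff_sq_norm: "g (Suc n) * sq_norm lam z P n = sq_norm lam z P (Suc n)"
proof -
  have 1: "[:0, 1:] * P (Suc n) = P (Suc (Suc n)) + smult (g (Suc n)) (P n)"
    using rec unfolding three_term_recurrence_def by (auto dest!: spec[of _ "Suc n"])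
  have 2: "[:0, 1:] * P n = P (Suc n) + smult (g n) (if n = 0 then 0 else P (n - 1))"
    using rec unfolding three_term_recurrence_def by auto
  have o: "weighted_integral lam z (P i * P j) = 0" if "i \<noteq> j" for i j
    using orth that by (auto simp: monic_orthogonal_def)
  have [simp]: "weighted_integral lam z 0 = 0" using weighted_integral_smult[of z 0 0] by simp
  have "P n * ([:0, 1:] * P (Suc n)) = P n * P (Suc (Suc n)) + smult (g (Suc n)) ((P n)\<^sup>2)"
    unfolding 1 by (simp add: algebra_simps power2_eq_square)
  moreover have "P (Suc n) * ([:0, 1:] * P n)
      = (P (Suc n))\<^sup>2 + smult (g n) (if n = 0 then 0 else P (Suc n) * P (n - 1))"
    unfolding 2 by (simp add: algebra_simps power2_eq_square)
  moreover have "P n * ([:0, 1:] * P (Suc n)) = P (Suc n) * ([:0, 1:] * P n)"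
    by (simp only: mult_ac)
  ultimately have "weighted_integral lam z (P n * P (Suc (Suc n)) + smult (g (Suc n)) ((P n)\<^sup>2))
      = weighted_integral lam z
          ((P (Suc n))\<^sup>2 + smult (g n) (if n = 0 then 0 else P (Suc n) * P (n - 1)))"
    by simp
  then show ?thesis
    by (simp add: weighted_integral_add weighted_integral_smult o sq_norm_def
        split: if_splits)
qed

text \<open>Squaring the recurrence leaves no cross term by orthogonality, and one factor
  \<open>g n\<close> in \<open>g n * g n\<close> turns the norm of \<open>P (n - 1)\<close> into
  that of \<open>P n\<close>. For \<open>n = 0\<close> the extra term vanishes with
  \<open>g 0\<close>.\<close>

lemma weighted_integral_x_square:
  "weighted_integral lam z (([:0, 1:] * P n)\<^sup>2)
    = sq_norm lam z P (Suc n) + g n * sq_norm lam z P n"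
proof (cases n)
  case 0
  have g0: "g 0 = 0" and "\<forall>n. [:0, 1:] * P n = P (n + 1) + smult (g n) (if n = 0 then 0 else P (n - 1))"
    using rec unfolding three_term_recurrence_def by blast+
  then have "[:0, 1:] * P 0 = P (Suc 0)" by (metis Suc_eq_plus1 add_0 add.right_neutral smult_0_left)
  with g0 show ?thesis unfolding 0 sq_norm_def by simp
next
  case (Suc m)
  have 1: "[:0, 1:] * P n = P (Suc n) + smult (g n) (P m)"
    using rec Suc unfolding three_term_recurrence_def by (auto dest!: spec[of _ "Suc m"])
  have "([:0, 1:] * P n)\<^sup>2
      = (P (Suc n))\<^sup>2 + (smult (2 * g n) (P (Suc n) * P m) + smult (g n * g n) ((P m)\<^sup>2))"
    unfolding 1 poly_eq_poly_eq_iff[symmetric]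
    by (auto simp: fun_eq_iff power2_eq_square algebra_simps)
  moreover have "weighted_integral lam z (P (Suc n) * P m) = 0"
    using orth Suc by (auto simp: monic_orthogonal_def)
  ultimately show ?thesis
    using recurrence_coeff_sq_norm[of m] Suc
    by (simp add: weighted_integral_add weighted_integral_smult flip: sq_norm_def)
qed

end

end

end

section \<open>Varying the parameter: the Toda-type equations\<close>

theorem theorem6p2:
  fixes lam :: real
    and P :: "real \<Rightarrow> nat \<Rightarrow> real poly"
    and gam :: "real \<Rightarrow> nat \<Rightarrow> real"
    and h :: "real \<Rightarrow> nat \<Rightarrow> real"
  assumes lam: "lam > - 1/2" "lam \<noteq> 1/2"
    and orth: "\<And>z. z > 0 \<Longrightarrow> monic_orthogonal lam z (P z)"
    and recur: "\<And>z. z > 0 \<Longrightarrow> three_term_recurrence (P z) (gam z)"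
    and h: "\<And>z n. z > 0 \<Longrightarrow> h z n = sq_norm lam z (P z) n"
  shows "(\<forall>z>0. \<forall>n.
            ((\<lambda>t. ln (h t n)) has_real_derivative (- gam z (n + 1) - gam z n)) (at z)) \<and>
         (\<forall>z>0. \<forall>n\<ge>1.
            ((\<lambda>t. ln (gam t n)) has_real_derivative (gam z (n - 1) - gam z (n + 1))) (at z))"
proof -
  define F where "F n z = weighted_integral lam z (([:0, 1:] * P z n)\<^sup>2)" for n z
  have hpos: "h z n > 0" if "z > 0" for z n
    unfolding h[OF that] by (rule sq_norm_pos[OF lam(1) orth[OF that]])
  have gam: "gam z (Suc n) = h z (Suc n) / h z n" if "z > 0" for z n
    using recurrence_coeff_sq_norm[OF lam(1) orth[OF that] recur[OF that], of n] hpos[OF that, of n]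
    by (simp add: h that field_simps)
  have gam0: "gam z 0 = 0" if "z > 0" for z
    using recur[OF that] by (simp add: three_term_recurrence_def)
  have Feq: "F n z = h z (Suc n) + gam z n * h z n" if "z > 0" for z n
    using weighted_integral_x_square[OF lam(1) orth[OF that] recur[OF that]] h that
    by (simp add: F_def)
  have bnd: "h w n \<le> (1 + (w - z)\<^sup>2) * h z n - (w - z) * F n z"
    if "w > 0" "z > 0" "\<bar>w - z\<bar> \<le> 1" for w z n
  proof -
    \<comment> \<open>The polynomial belonging to \<open>z\<close> serves as a competitor in the
      minimum problem at \<open>w\<close>; afterwards only the weight changes.\<close>
    have "h w n \<le> weighted_integral lam w ((P z n)\<^sup>2)"
      using sq_norm_minimal[OF lam(1) orth[OF that(1)], of "P z n" n] 
        monic_orthogonal_deg[OF lam(1) orth[OF that(2)]] that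
      by (simp add: h)
    with weighted_integral_square_le[OF lam(1) that(3), of "P z n"] show ?thesis
      using that by (simp add: h sq_norm_def F_def)
  qed
  have Fle: "0 \<le> F n z \<and> F n z \<le> h z n" if "z > 0" for n z
  proof
    show "0 \<le> F n z" unfolding F_def by (rule weighted_integral_square_nonneg[OF lam(1)])
    have "F n z \<le> weighted_integral lam z ((P z n)\<^sup>2)"
      unfolding F_def
    proof (rule weighted_integral_mono[OF lam(1)], rule mult_right_mono)
      fix x :: real assume "x \<in> {-1<..<1}"
      then have "x\<^sup>2 \<le> 1" by (simp add: abs_square_le_1 abs_le_iff)
      then show "poly (([:0, 1:] * P z n)\<^sup>2) x \<le> poly ((P z n)\<^sup>2) x"
        by (simp add: power_mult_distrib mult_left_le_one_le)
    qed (simp add: gegenbauer_weight_def)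
    then show "F n z \<le> h z n" using that by (simp add: h sq_norm_def)
  qed
  have hcont: "isCont (\<lambda>t. h t n) z" if "z > 0" for z n
    by (rule isCont_from_quadratic_bounds[OF bnd Fle that])
  have Fcont: "isCont (F n) z" if "z > 0" for z n
  proof -
    have ev: "\<forall>\<^sub>F t in nhds z. t > 0"
      using that eventually_nhds_in_open[of "{0<..}" z] by simp
    \<comment> \<open>Eliminating \<open>gam\<close> expresses \<open>F n\<close> through the
      \<open>h\<close> alone, whose continuity is known. The identity holds only for positive
      \<open>t\<close>, hence on a neighbourhood of \<open>z\<close>.\<close>
    have "isCont (\<lambda>t. h t (Suc n) + (case n of 0 \<Rightarrow> 0 | Suc m \<Rightarrow> h t n / h t m * h t n)) z"
      using that hpos[OF that]
      by (cases n) (auto intro!: continuous_intros hcont simp: less_imp_neq[symmetric])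
    moreover have "\<forall>\<^sub>F t in nhds z.
        F n t = h t (Suc n) + (case n of 0 \<Rightarrow> 0 | Suc m \<Rightarrow> h t n / h t m * h t n)"
      using ev by eventually_elim (auto simp: Feq gam gam0 split: nat.split)
    ultimately show ?thesis by (simp add: isCont_cong)
  qed
  have dh: "((\<lambda>t. ln (h t n)) has_real_derivative (- gam z (n + 1) - gam z n)) (at z)"
    if "z > 0" for z n
  proof -
    have "((\<lambda>t. h t n) has_real_derivative - F n z) (at z)"
      by (rule DERIV_from_quadratic_bounds[OF bnd hcont[OF that] Fcont[OF that] that])
    \<comment> \<open>The chain rule yields \<open>- F n z / h z n\<close>, and \<open>Feq\<close>
      with \<open>gam\<close> rewrites the quotient as the sum of two recurrence
      coefficients.\<close>
    from DERIV_chain2[where f = ln and g = "\<lambda>t. h t n", OF DERIV_ln_divide[OF hpos[OF that]] this]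
    show ?thesis
      using hpos[OF that, of n] that by (simp add: Feq gam field_simps)
  qed
  have dgam: "((\<lambda>t. ln (gam t n)) has_real_derivative (gam z (n - 1) - gam z (n + 1))) (at z)"
    if "z > 0" "n \<ge> 1" for z n
  proof -
    obtain m where n: "n = Suc m" using \<open>n \<ge> 1\<close> by (cases n) auto
    have ev: "\<forall>\<^sub>F t in nhds z. t > 0"
      using that eventually_nhds_in_open[of "{0<..}" z] by simp
    have "\<forall>\<^sub>F t in nhds z. ln (gam t n) = ln (h t n) - ln (h t m)"
      using ev
    proof eventually_elim
      case (elim t)
      then show ?case using hpos[OF elim, of n] hpos[OF elim, of m] by (simp add: gam n ln_div)
    qed
    \<comment> \<open>In the difference of the two derivatives the terms \<open>gam z n\<close>
      cancel, as \<open>n = m + 1\<close>.\<close>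
    moreover have "((\<lambda>t. ln (h t n) - ln (h t m)) has_real_derivative
        (gam z (n - 1) - gam z (n + 1))) (at z)"
      using DERIV_diff[OF dh[OF that(1), of n] dh[OF that(1), of m]] by (simp add: n)
    ultimately show ?thesis by (subst DERIV_cong_ev[OF refl _ refl])
  qed
  show ?thesis using dh dgam by blast
qed

end
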